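(* Let $\zeta<0$ and $\eta\ge0$ be real numbers, and let $\varphi(z)=\frac{e^z-1}{z}$ for $z\ne0$, $\varphi(0)=1$. Then $\varphi(\eta\lambda)(\lambda+\zeta)\in[\zeta,0]$ for all real $\lambda\le 0$ if, and only if, $\eta\ge 2/|\zeta|$. *)

theory Defs
  imports Complex_Main
begin

definition phi :: "'a::{real_normed_field,banach} \<Rightarrow> 'a" where
  "phi z = (if z = 0 then 1 else (exp z - 1) / z)"

end

theory Submission
  imports Defs
begin

text \<open>
  For \<open>x < 0\<close> put \<open>t = - \<eta> x\<close> and \<open>b = \<eta> \<bar>\<zeta>\<bar>\<close>. The upper bound \<open>0\<close> is automatic, and the
  lower bound \<open>\<zeta>\<close> becomes \<open>t (1 - e\<^sup>-\<^sup>t) \<le> b (t - 1 + e\<^sup>-\<^sup>t)\<close>. As \<open>t \<rightarrow> 0\<close> both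
  sides are of second order, with leading coefficients \<open>1\<close> and \<open>b / 2\<close>, which forces \<open>b \<ge> 2\<close>;
  the case \<open>b = 2\<close> is the Pade-type bound \<open>2 - t \<le> (2 + t) e\<^sup>-\<^sup>t\<close>, and the right-hand side
  increases with \<open>b\<close>.
\<close>

lemma phi_minus:
  fixes t :: real
  assumes "t \<noteq> 0"
  shows "phi (- t) = (1 - exp (- t)) / t"
  using assms by (simp add: phi_def field_simps)

text \<open>The difference of the two sides vanishes at 0, and its derivative
  \<open>1 - (1 + x) * exp (- x)\<close> is nonnegative because
  \<open>1 + x \<le> exp x\<close>.\<close>

lemma exp_minus_ge_pade:
  fixes t :: real
  assumes "0 \<le> t"
  shows "2 - t \<le> (2 + t) * exp (- t)"
proof -
  let ?g = "\<lambda>t::real. (2 + t) * exp (- t) - (2 - t)"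
  have "?g 0 \<le> ?g t"
  proof (rule DERIV_nonneg_imp_nondecreasing[OF assms])
    fix x :: real
    assume "0 \<le> x"
    have "(?g has_real_derivative 1 - (1 + x) * exp (- x)) (at x)"
      by (auto intro!: derivative_eq_intros simp: algebra_simps)
    moreover have "(1 + x) * exp (- x) \<le> exp x * exp (- x)"
      by (intro mult_right_mono exp_ge_add_one_self) simp
    ultimately show "\<exists>y. (?g has_real_derivative y) (at x) \<and> 0 \<le> y"
      by (auto simp: exp_minus_inverse)
  qed
  then show ?thesis by simp
qed

text \<open>Multiplied by \<open>1 + t + t\<^sup>2 / 2\<close>, which is at most
  \<open>exp t\<close>, the right-hand side becomes \<open>1 + t^4 / 4\<close>, hence at least
  1.\<close>

lemma exp_minus_le_quadratic:
  fixes t :: real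
  assumes "0 \<le> t"
  shows "exp (- t) \<le> 1 - t + t\<^sup>2 / 2"
proof -
  have q: "0 \<le> 1 - t + t\<^sup>2 / 2"
    using zero_le_power2[of "t - 1"] by (simp add: power2_eq_square algebra_simps)
  have "1 \<le> 1 + (t\<^sup>2)\<^sup>2 / 4" by simp
  also have "\<dots> = (1 - t + t\<^sup>2 / 2) * (1 + t + t\<^sup>2 / 2)"
    by (simp add: power2_eq_square field_simps)
  also have "\<dots> \<le> (1 - t + t\<^sup>2 / 2) * exp t"
    by (intro mult_left_mono exp_lower_Taylor_quadratic assms q)
  finally show ?thesis by (simp add: exp_minus field_simps)
qed

text \<open>The gap in the first inequality is the gap in the second divided by
  \<open>t * \<eta> > 0\<close>; both directions of the theorem use this form.\<close>

lemma phi_mult_ge_iff: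
  fixes \<zeta> \<eta> x :: real
  assumes "\<eta> > 0" "x < 0"
  defines "t \<equiv> - (\<eta> * x)"
  shows "\<zeta> \<le> phi (\<eta> * x) * (x + \<zeta>) \<longleftrightarrow>
    t * (1 - exp (- t)) \<le> (- \<zeta> * \<eta>) * (t - 1 + exp (- t))"
proof -
  have t: "t > 0" using assms by (simp add: t_def mult_pos_neg)
  have x: "x = - t / \<eta>" using assms by (simp add: t_def)
  have "\<eta> * x = - t" by (simp add: t_def)
  then have phi: "phi (\<eta> * x) = (1 - exp (- t)) / t"
    using phi_minus[of t] t by simp
  have "phi (\<eta> * x) * (x + \<zeta>) - \<zeta> =
      ((- \<zeta> * \<eta>) * (t - 1 + exp (- t)) - t * (1 - exp (- t))) / (t * \<eta>)"
    using t assms(1) unfolding phi unfolding x by (simp add: field_simps)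
  moreover have "0 \<le> d / (t * \<eta>) \<longleftrightarrow> 0 \<le> d" for d
    using t assms(1) by (auto simp: zero_le_divide_iff mult_le_0_iff)
  ultimately show ?thesis by (metis diff_ge_0_iff_ge)
qed

lemma phi_nonneg:
  fixes x :: real
  shows "0 \<le> phi x"
  by (auto simp: phi_def zero_le_divide_iff)

theorem theorem2p7:
  fixes \<zeta> \<eta> :: real
  assumes "\<zeta> < 0" and "\<eta> \<ge> 0"
  shows "(\<forall>x::real. x \<le> 0 \<longrightarrow> phi (\<eta> * x) * (x + \<zeta>) \<in> {\<zeta>..0}) \<longleftrightarrow> \<eta> \<ge> 2 / \<bar>\<zeta>\<bar>"
proof -
  define b where "b = - \<zeta> * \<eta>"
  have b_iff: "\<eta> \<ge> 2 / \<bar>\<zeta>\<bar> \<longleftrightarrow> b \<ge> 2"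
    using assms(1) by (auto simp: b_def field_simps)
  show ?thesis
    unfolding b_iff
  proof
    assume *: "\<forall>x::real. x \<le> 0 \<longrightarrow> phi (\<eta> * x) * (x + \<zeta>) \<in> {\<zeta>..0}"
    \<comment> \<open>For \<open>\<eta> = 0\<close> the factor \<open>phi 0\<close> is 1, and
      \<open>x = -1\<close> gives \<open>\<zeta> - 1 < \<zeta>\<close>.\<close>
    have "\<eta> \<noteq> 0"
      using *[rule_format, of "-1"] by (auto simp: phi_def)
    with assms have \<eta>: "\<eta> > 0" by simp
    show "b \<ge> 2"
    proof (rule ccontr)
      assume "\<not> b \<ge> 2"
      \<comment> \<open>The quadratic bound, used on both sides, would force
        \<open>1 - t / 2 \<le> b / 2\<close>, that is \<open>t \<ge> 2 - b\<close>; half of that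
        threshold violates it.\<close>
      define t where "t = (2 - b) / 2"
      have t: "t > 0" "b / 2 < 1 - t / 2" using \<open>\<not> b \<ge> 2\<close> by (auto simp: t_def field_simps)
      have b: "b \<ge> 0" using assms by (simp add: b_def mult_nonpos_nonneg)
      have e: "exp (- t) \<le> 1 - t + t\<^sup>2 / 2"
        using exp_minus_le_quadratic t(1) by simp
      have "t * (t - t\<^sup>2 / 2) \<le> t * (1 - exp (- t))"
        using t(1) e by (intro mult_left_mono) auto
      also have "\<dots> \<le> b * (t - 1 + exp (- t))"
        using *[rule_format, of "- t / \<eta>"] phi_mult_ge_iff[of \<eta> "- t / \<eta>" \<zeta>] \<eta> t(1)
        by (simp add: b_def)
      also have "\<dots> \<le> b * (t\<^sup>2 / 2)"
        using b e by (intro mult_left_mono) auto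
      finally have "t\<^sup>2 * (1 - t / 2) \<le> t\<^sup>2 * (b / 2)"
        by (simp add: power2_eq_square algebra_simps)
      then show False using t by simp
    qed
  next
    assume b: "b \<ge> 2"
    with assms have \<eta>: "\<eta> > 0" by (cases "\<eta> = 0") (auto simp: b_def)
    show "\<forall>x::real. x \<le> 0 \<longrightarrow> phi (\<eta> * x) * (x + \<zeta>) \<in> {\<zeta>..0}"
    proof (intro allI impI)
      fix x :: real
      assume x: "x \<le> 0"
      have upper: "phi (\<eta> * x) * (x + \<zeta>) \<le> 0"
        using x assms(1) by (intro mult_nonneg_nonpos phi_nonneg) auto
      have lower: "\<zeta> \<le> phi (\<eta> * x) * (x + \<zeta>)"
      proof (cases "x = 0")
        case False
        define t where "t = - (\<eta> * x)"
        have t: "t \<ge> 0" using \<eta> x by (simp add: t_def mult_nonneg_nonpos)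
        \<comment> \<open>The case \<open>b = 2\<close>, a rearrangement of the Pade-type
          bound.\<close>
        have "t * (1 - exp (- t)) \<le> 2 * (t - 1 + exp (- t))"
          using exp_minus_ge_pade[OF t] by (simp add: algebra_simps)
        also have "\<dots> \<le> b * (t - 1 + exp (- t))"
          using b exp_ge_add_one_self[of "- t"] by (intro mult_right_mono) auto
        finally show ?thesis
          using phi_mult_ge_iff[of \<eta> x \<zeta>] \<eta> x False by (simp add: b_def t_def)
      qed (simp add: phi_def)
      show "phi (\<eta> * x) * (x + \<zeta>) \<in> {\<zeta>..0}"
        using upper lower by simp
    qed
  qed
qed

end
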